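(* Let $A\in\mathbb{R}^{d\times d}$ be a symmetric positive definite matrix with largest and smallest eigenvalues $L$ and $\ell>0$, respectively, and condition number $\kappa=L/\ell>1$. Let $\eta>0$ be a damping parameter and set $$s=\left\lceil\sqrt{(\kappa-1)\eta/2}\,\right\rceil,\quad \omega_0=1+\frac{\eta}{s^2},\quad \omega_1=\frac{T_s(\omega_0)}{T_s'(\omega_0)},\quad h=\frac{\omega_0-1}{\omega_1\ell},\quad \alpha_s(\eta)=\frac1{T_s(\omega_0)},\quad C(\eta)=\frac{\omega_1\alpha_s(\eta)}{\omega_0-1},$$ where $T_s$ is the Chebyshev polynomial of the first kind of degree $s$. Let $\gamma>0$ and let $g:\mathbb{R}^d\to\mathbb{R}$ be a $\beta$-smooth convex function with $0<\beta<C(\eta)\gamma\ell$. Let $f(x)=\tfrac12x^TAx+g(x)$, with minimizer $x_*$. Then the iterates $\{x_n\}_{n\ge0}$ of the partitioned Runge--Kutta Chebyshev descent method (PRKCD) with these parameters, started from any $x_0\in\mathbb{R}^d$, satisfy, for every $n\ge 0$, $$f(x_{n+1})-f(x_* )\le(1+\gamma)^2\alpha_s(\eta)^2\,\bigl(f(x_n)-f(x_* )\bigr).$$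
   Context: $T_s$ is determined by $T_s(\cos\theta)=\cos(s\theta)$. A $\beta$-smooth function is a differentiable function whose gradient is $\beta$-Lipschitz in the Euclidean norm. One iteration of PRKCD from $x_n$ to $x_{n+1}$: set $x_n^0=x_n$, $$x_n^1=x_n-h\mu_1\bigl(Ax_n+\nabla g(x_n)\bigr),\qquad \mu_1=\frac{\omega_1}{\omega_0},$$ and for $j=2,\dots,s$, $$x_n^j=-\mu_jh\bigl(Ax_n^{j-1}+\nabla g(x_n)\bigr)+\nu_jx_n^{j-1}-(\nu_j-1)x_n^{j-2},$$ $$\mu_j=\frac{2\omega_1T_{j-1}(\omega_0)}{T_j(\omega_0)},\qquad \nu_j=\frac{2\omega_0T_{j-1}(\omega_0)}{T_j(\omega_0)};$$ then set $x_{n+1}=x_n^s$. (The gradient of $g$ is evaluated only at $x_n$ in all internal stages.) *)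

theory Defs
  imports "HOL-Analysis.Analysis" "HOL-Computational_Algebra.Polynomial"
begin

definition chebyshev_T :: "nat \<Rightarrow> real poly" where
  "chebyshev_T n = (THE p. \<forall>t. poly p (cos t) = cos (real n * t))"

lemma chebyshev_T_exists: "\<exists>p. \<forall>t. poly p (cos t) = cos (real n * t)"
proof (induction n rule: induct_nat_012)
  case 0
  show ?case by (rule exI[of _ 1]) simp
next
  case 1
  show ?case by (rule exI[of _ "[:0, 1:]"]) simp
next
  case (ge2 n)
  then obtain p q where p: "\<And>t. poly p (cos t) = cos (real n * t)"
    and q: "\<And>t. poly q (cos t) = cos (real (Suc n) * t)" by blast
  have "poly ([:0, 2:] * q - p) (cos t) = cos (real (Suc (Suc n)) * t)" for t
  proof -
    have "cos (real (Suc (Suc n)) * t) = cos (real (Suc n) * t + t)"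
      and "cos (real n * t) = cos (real (Suc n) * t - t)"
      by (simp_all add: algebra_simps)
    then show ?thesis by (simp only: cos_add cos_diff) (simp add: p q cos_diff algebra_simps)
  qed
  then show ?case by blast
qed

lemma chebyshev_T_unique:
  assumes p: "\<And>t. poly p (cos t) = cos (real n * t)"
    and q: "\<And>t. poly q (cos t) = cos (real n * t)"
  shows "p = (q :: real poly)"
proof (rule ccontr)
  assume "p \<noteq> q"
  then have fin: "finite {x. poly (p - q) x = 0}" by (intro poly_roots_finite) simp
  have "{-1..1} \<subseteq> {x. poly (p - q) x = 0}"
  proof
    fix x :: real assume "x \<in> {-1..1}"
    then have "cos (arccos x) = x" by simp
    then show "x \<in> {x. poly (p - q) x = 0}"
      using p[of "arccos x"] q[of "arccos x"] by simp
  qed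
  with fin have "finite {-1..1::real}" by (rule rev_finite_subset)
  then show False by (simp add: infinite_Icc)
qed

lemma poly_chebyshev_T_cos: "poly (chebyshev_T n) (cos t) = cos (real n * t)"
proof -
  have "\<exists>!p. \<forall>t. poly p (cos t) = cos (real n * t)"
    using chebyshev_T_exists chebyshev_T_unique by blast
  from theI'[OF this] show ?thesis unfolding chebyshev_T_def by blast
qed

definition symmetric_pos_def :: "real ^ 'd ^ 'd \<Rightarrow> bool" where
  "symmetric_pos_def A \<longleftrightarrow> transpose A = A \<and> (\<forall>v. v \<noteq> 0 \<longrightarrow> v \<bullet> (A *v v) > 0)"

definition eigenvalues :: "real ^ 'd ^ 'd \<Rightarrow> real set" where
  "eigenvalues A = {c. \<exists>v. v \<noteq> 0 \<and> A *v v = c *\<^sub>R v}"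

definition gradient :: "('a::euclidean_space \<Rightarrow> real) \<Rightarrow> 'a \<Rightarrow> 'a" where
  "gradient g x = (THE D. GDERIV g x :> D)"

lemma GDERIV_gradient:
  assumes "g differentiable (at x)"
  shows "GDERIV g x :> gradient g x"
proof -
  obtain g' where g': "(g has_derivative g') (at x)"
    using assms unfolding differentiable_def by blast
  then interpret bounded_linear g' by (rule has_derivative_bounded_linear)
  have "g' = (\<lambda>v. v \<bullet> (\<Sum>b\<in>Basis. g' b *\<^sub>R b))"
  proof
    fix v
    have "g' v = g' (\<Sum>b\<in>Basis. (v \<bullet> b) *\<^sub>R b)" by (simp add: euclidean_representation)
    also have "\<dots> = v \<bullet> (\<Sum>b\<in>Basis. g' b *\<^sub>R b)"
      by (simp add: sum scaleR inner_sum_right mult.commute)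
    finally show "g' v = v \<bullet> (\<Sum>b\<in>Basis. g' b *\<^sub>R b)" .
  qed
  with g' have D: "GDERIV g x :> (\<Sum>b\<in>Basis. g' b *\<^sub>R b)"
    by (simp add: gderiv_def)
  have unique: "E = F" if E: "GDERIV g x :> E" and F: "GDERIV g x :> F" for E F
  proof -
    have "(\<lambda>v. v \<bullet> E) = (\<lambda>v. v \<bullet> F)"
      using has_derivative_unique that unfolding gderiv_def by blast
    then have "v \<bullet> E = v \<bullet> F" for v by metis
    then have "(E - F) \<bullet> (E - F) = 0" by (simp add: inner_diff_right)
    then show "E = F" by simp
  qed
  show ?thesis unfolding gradient_def
    by (rule theI[of _ "\<Sum>b\<in>Basis. g' b *\<^sub>R b"]) (use D unique in blast)+
qed

definition beta_smooth :: "real \<Rightarrow> ('a::euclidean_space \<Rightarrow> real) \<Rightarrow> bool" where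
  "beta_smooth \<beta> g \<longleftrightarrow> (\<forall>x. g differentiable (at x)) \<and> \<beta>-lipschitz_on UNIV (gradient g)"

definition rkc_mu :: "real \<Rightarrow> real \<Rightarrow> nat \<Rightarrow> real" where
  "rkc_mu \<omega>\<^sub>0 \<omega>\<^sub>1 j =
     2 * \<omega>\<^sub>1 * poly (chebyshev_T (j - 1)) \<omega>\<^sub>0 / poly (chebyshev_T j) \<omega>\<^sub>0"

definition rkc_nu :: "real \<Rightarrow> nat \<Rightarrow> real" where
  "rkc_nu \<omega>\<^sub>0 j =
     2 * \<omega>\<^sub>0 * poly (chebyshev_T (j - 1)) \<omega>\<^sub>0 / poly (chebyshev_T j) \<omega>\<^sub>0"

text \<open>Internal stages of one step from \<open>x\<close>. The first stage uses \<open>\<omega>\<^sub>1 / \<omega>\<^sub>0\<close>, which is half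
  of \<open>rkc_mu \<omega>\<^sub>0 \<omega>\<^sub>1 1\<close>.\<close>

fun prkcd_stage ::
  "real ^ 'd ^ 'd \<Rightarrow> (real ^ 'd \<Rightarrow> real) \<Rightarrow> real \<Rightarrow> real \<Rightarrow> real \<Rightarrow> real ^ 'd \<Rightarrow> nat \<Rightarrow> real ^ 'd"
where
  "prkcd_stage A g h \<omega>\<^sub>0 \<omega>\<^sub>1 x 0 = x"
| "prkcd_stage A g h \<omega>\<^sub>0 \<omega>\<^sub>1 x (Suc 0) =
     x - (h * (\<omega>\<^sub>1 / \<omega>\<^sub>0)) *\<^sub>R (A *v x + gradient g x)"
| "prkcd_stage A g h \<omega>\<^sub>0 \<omega>\<^sub>1 x (Suc (Suc j)) =
     - ((rkc_mu \<omega>\<^sub>0 \<omega>\<^sub>1 (Suc (Suc j)) * h) *\<^sub>R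
          (A *v prkcd_stage A g h \<omega>\<^sub>0 \<omega>\<^sub>1 x (Suc j) + gradient g x))
     + rkc_nu \<omega>\<^sub>0 (Suc (Suc j)) *\<^sub>R prkcd_stage A g h \<omega>\<^sub>0 \<omega>\<^sub>1 x (Suc j)
     - (rkc_nu \<omega>\<^sub>0 (Suc (Suc j)) - 1) *\<^sub>R prkcd_stage A g h \<omega>\<^sub>0 \<omega>\<^sub>1 x j"

definition prkcd_step ::
  "real ^ 'd ^ 'd \<Rightarrow> (real ^ 'd \<Rightarrow> real) \<Rightarrow> nat \<Rightarrow> real \<Rightarrow> real \<Rightarrow> real \<Rightarrow> real ^ 'd \<Rightarrow> real ^ 'd"
where
  "prkcd_step A g s h \<omega>\<^sub>0 \<omega>\<^sub>1 x = prkcd_stage A g h \<omega>\<^sub>0 \<omega>\<^sub>1 x s"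

end

theory Submission
  imports Defs
begin

text \<open>With \<open>P(\<lambda>) = T\<^sub>s(\<omega>\<^sub>0 - \<omega>\<^sub>1 h \<lambda>) / T\<^sub>s(\<omega>\<^sub>0)\<close>, unrolling the stages gives
  \<open>x\<^sub>n\<^sub>+\<^sub>1 = x\<^sub>n - B \<nabla>f(x\<^sub>n)\<close> for \<open>B = A\<^sup>-\<^sup>1 (I - P(A))\<close>. In the variable \<open>v = B\<^sup>-\<^sup>1\<^sup>/\<^sup>2 x\<close> this is a
  gradient step of length \<open>1\<close> for \<open>F(v) = f(B\<^sup>1\<^sup>/\<^sup>2 v)\<close>, whose quadratic part is \<open>I - P(A)\<close>. On the
  spectrum of \<open>A\<close> one has \<open>\<bar>P\<bar> \<le> \<alpha>\<close>, and \<open>B \<le> h I\<close> because \<open>T\<^sub>s\<close> lies above its tangent at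
  \<open>\<omega>\<^sub>0\<close>; since \<open>h \<beta> \<le> \<alpha> \<gamma>\<close>, \<open>F\<close> is \<open>(1 - \<rho>)\<close>-strongly convex and \<open>(1 + \<rho>)\<close>-smooth for
  \<open>\<rho> = \<alpha> (1 + \<gamma>)\<close>. For such functions the unit gradient step contracts the objective gap by \<open>\<rho>\<^sup>2\<close>.\<close>

section \<open>The unit gradient step\<close>

text \<open>The lower bound based at \<open>y\<close> and the upper bound based at \<open>x\<close>
  are compared at one point \<open>u\<close>, chosen to minimize upper minus lower. The constant is
  that of a convex function with a 2\<rho>-Lipschitz gradient.\<close>

lemma smooth_interpolation:
  fixes Q :: "'a::real_inner \<Rightarrow> real"
  assumes "\<rho> > 0"
    and lower: "\<And>y u. Q y + q y \<bullet> (u - y) \<le> Q u"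
    and upper: "\<And>y u. Q u \<le> Q y + q y \<bullet> (u - y) + \<rho> * (norm (u - y))\<^sup>2"
  shows "Q y + q y \<bullet> (x - y) + (norm (q x - q y))\<^sup>2 / (4 * \<rho>) \<le> Q x"
proof -
  define w where "w = q x - q y"
  define u where "u = x - (1 / (2 * \<rho>)) *\<^sub>R w"
  have "Q y + q y \<bullet> (u - y) \<le> Q x + q x \<bullet> (u - x) + \<rho> * (norm (u - x))\<^sup>2"
    using lower upper order_trans by blast
  moreover have "q y \<bullet> (u - y) = q y \<bullet> (x - y) - (q y \<bullet> w) / (2 * \<rho>)"
    by (simp add: u_def inner_diff_right)
  moreover have "q x \<bullet> (u - x) = - ((q y \<bullet> w + w \<bullet> w) / (2 * \<rho>))"
    by (simp add: u_def w_def inner_diff_left)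
  moreover have "\<rho> * (norm (u - x))\<^sup>2 = (w \<bullet> w) / (4 * \<rho>)"
    using \<open>\<rho> > 0\<close> by (simp add: u_def power_divide power2_norm_eq_inner) (simp add: power2_eq_square)
  moreover have "(norm (q x - q y))\<^sup>2 / (4 * \<rho>) = (w \<bullet> w) / (4 * \<rho>)"
    by (simp add: w_def power2_norm_eq_inner)
  moreover have "(q y \<bullet> w + w \<bullet> w) / (2 * \<rho>) = (q y \<bullet> w) / (2 * \<rho>) + 2 * ((w \<bullet> w) / (4 * \<rho>))"
    using \<open>\<rho> > 0\<close> by (simp add: field_simps)
  ultimately show ?thesis by linarith
qed

text \<open>If \<open>\<rho> \<ge> 1\<close>, the upper bound alone suffices. If \<open>\<rho> < 1\<close>, the rate comes
  from adding three interpolation inequalities between \<open>xs\<close>, \<open>y\<close> and \<open>y - G y\<close>, with the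
  weights \<open>\<rho>\<close>, \<open>\<rho> (1 - \<rho>)\<close>, \<open>1 - \<rho>\<close> known from the worst-case analysis of gradient descent
  with step \<open>2 / (\<mu> + L)\<close>; what remains is a perfect square.\<close>

lemma gradient_step_contraction:
  fixes F :: "'a::real_inner \<Rightarrow> real"
  assumes "\<rho> > 0"
    and lower: "\<And>y u. F y + G y \<bullet> (u - y) + (1 - \<rho>) / 2 * (norm (u - y))\<^sup>2 \<le> F u"
    and upper: "\<And>y u. F u \<le> F y + G y \<bullet> (u - y) + (1 + \<rho>) / 2 * (norm (u - y))\<^sup>2"
    and xs: "\<And>y. F xs \<le> F y"
  shows "F (y - G y) - F xs \<le> \<rho>\<^sup>2 * (F y - F xs)"
proof -
  \<comment> \<open>The upper bound is taken at its minimizer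
    \<open>y - (1 / (1 + \<rho>)) *\<^sub>R G y\<close>.\<close>
  have gap: "G y \<bullet> G y \<le> 2 * (1 + \<rho>) * (F y - F xs)" for y
  proof -
    have scalar: "r / 2 * (c / r\<^sup>2) - c / r = - (c / (2 * r))" if "r > 0" for r c :: real
      using that by (simp add: field_simps power2_eq_square)
    have "F xs \<le> F y + G y \<bullet> ((y - (1 / (1 + \<rho>)) *\<^sub>R G y) - y)
        + (1 + \<rho>) / 2 * (norm ((y - (1 / (1 + \<rho>)) *\<^sub>R G y) - y))\<^sup>2"
      using xs upper order_trans by blast
    also have "\<dots> = F y - (G y \<bullet> G y) / (2 * (1 + \<rho>))"
      using scalar[of "1 + \<rho>" "G y \<bullet> G y"] \<open>\<rho> > 0\<close>
      by (simp add: power_divide power2_norm_eq_inner)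
    finally show ?thesis using \<open>\<rho> > 0\<close> by (simp add: field_simps)
  qed
  show ?thesis
  proof (cases "\<rho> \<ge> 1")
    case True
    have "F (y - G y) \<le> F y + (\<rho> - 1) / 2 * (G y \<bullet> G y)"
      using upper[of "y - G y" y] by (simp add: power2_norm_eq_inner field_simps)
    moreover have "(\<rho> - 1) / 2 * (G y \<bullet> G y) \<le> (\<rho> - 1) / 2 * (2 * (1 + \<rho>) * (F y - F xs))"
      using True by (intro mult_left_mono gap) auto
    moreover have "(\<rho> - 1) / 2 * (2 * (1 + \<rho>) * (F y - F xs)) = (\<rho>\<^sup>2 - 1) * (F y - F xs)"
      by (simp add: field_simps power2_eq_square)
    ultimately show ?thesis by (simp add: algebra_simps)
  next
    case False
    have "G xs \<bullet> G xs \<le> 0" using gap[of xs] by simp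
    then have "G xs = 0" by (metis inner_gt_zero_iff not_le)
    \<comment> \<open>Removing the quadratic centred at \<open>xs\<close> leaves a convex,
      2\<rho>-smooth \<open>Q\<close> with gradient \<open>q\<close>, and keeps
      \<open>Q xs = F xs\<close> and \<open>q xs = 0\<close>.\<close>
    define Q where "Q z = F z - (1 - \<rho>) / 2 * ((z - xs) \<bullet> (z - xs))" for z
    define q where "q z = G z - (1 - \<rho>) *\<^sub>R (z - xs)" for z
    have expand: "(u - xs) \<bullet> (u - xs) = (z - xs) \<bullet> (z - xs) + 2 * ((z - xs) \<bullet> (u - z)) + (norm (u - z))\<^sup>2"
      for u z
      by (simp add: power2_norm_eq_inner inner_diff_left inner_diff_right inner_commute)
    have q_inner: "q z \<bullet> v = G z \<bullet> v - (1 - \<rho>) * ((z - xs) \<bullet> v)" for z v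
      by (simp only: q_def inner_diff_left[of "G z"] inner_scaleR_left)
    have lo: "Q z + q z \<bullet> (u - z) \<le> Q u" for z u
      using lower[of z u] unfolding Q_def q_inner expand[of u z]
      by (simp add: field_simps)
    have up: "Q u \<le> Q z + q z \<bullet> (u - z) + \<rho> * (norm (u - z))\<^sup>2" for z u
      using upper[of u z] unfolding Q_def q_inner expand[of u z]
      by (simp add: field_simps)
    have I: "4 * \<rho> * (Q z + q z \<bullet> (u - z) - Q u) + (q u - q z) \<bullet> (q u - q z) \<le> 0" for u z
      using smooth_interpolation[of \<rho> Q q z u, OF \<open>\<rho> > 0\<close> lo up] \<open>\<rho> > 0\<close>
      by (simp add: power2_norm_eq_inner field_simps)
    \<comment> \<open>Positions relative to \<open>xs\<close>: \<open>a\<close> for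
      \<open>y\<close>, \<open>b\<close> after one step, \<open>- m\<close> after two steps.\<close>
    define a where "a = y - xs"
    define b where "b = y - G y - xs"
    define m where "m = G (y - G y) - b"
    have q: "q y = \<rho> *\<^sub>R a - b" "q (y - G y) = m + \<rho> *\<^sub>R b" "q xs = 0"
      using \<open>G xs = 0\<close> by (simp_all add: q_def a_def b_def m_def algebra_simps)
    have Q: "Q y = F y - (1 - \<rho>) / 2 * (a \<bullet> a)" "Q xs = F xs"
      "Q (y - G y) = F (y - G y) - (1 - \<rho>) / 2 * (b \<bullet> b)"
      by (simp_all add: Q_def a_def b_def)
    have d: "y - (y - G y) = a - b" "xs - y = - a" "xs - (y - G y) = - b"
      by (simp_all add: a_def b_def)
    define I1 where "I1 = 4 * \<rho> * (Q (y - G y) + q (y - G y) \<bullet> (a - b) - Q y)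
      + (q y - q (y - G y)) \<bullet> (q y - q (y - G y))"
    define I2 where "I2 = 4 * \<rho> * (Q y - q y \<bullet> a - Q xs) + q y \<bullet> q y"
    define I3 where "I3 = 4 * \<rho> * (Q (y - G y) - q (y - G y) \<bullet> b - Q xs) + q (y - G y) \<bullet> q (y - G y)"
    have "I1 \<le> 0" "I2 \<le> 0" "I3 \<le> 0"
      using I[where u=y and z="y - G y"] I[where u=xs and z=y] I[where u=xs and z="y - G y"]
      by (simp_all only: I1_def I2_def I3_def d q(3)) simp_all
    then have "\<rho> * I1 + \<rho> * (1 - \<rho>) * I2 + (1 - \<rho>) * I3 \<le> 0"
      using \<open>\<rho> > 0\<close> False by (intro add_nonpos_nonpos mult_nonneg_nonpos) auto
    moreover have "(m + \<rho>\<^sup>2 *\<^sub>R a) \<bullet> (m + \<rho>\<^sup>2 *\<^sub>R a) \<ge> 0" by simp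
    \<comment> \<open>The weights make the values of \<open>F\<close> combine to the left side. The
      square vanishes when two steps scale the error \<open>a\<close> by exactly
      \<open>\<rho>\<^sup>2\<close>.\<close>
    moreover have "4 * \<rho> * (F (y - G y) - F xs - \<rho>\<^sup>2 * (F y - F xs)) =
        \<rho> * I1 + \<rho> * (1 - \<rho>) * I2 + (1 - \<rho>) * I3 - (m + \<rho>\<^sup>2 *\<^sub>R a) \<bullet> (m + \<rho>\<^sup>2 *\<^sub>R a)"
      unfolding I1_def I2_def I3_def q Q
      by (simp add: inner_add_left inner_add_right inner_diff_left inner_diff_right
          inner_commute[of b a] inner_commute[of m a] inner_commute[of m b])
        (simp add: field_simps power2_eq_square)
    ultimately have "4 * \<rho> * (F (y - G y) - F xs - \<rho>\<^sup>2 * (F y - F xs)) \<le> 0" by linarith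
    then show ?thesis using \<open>\<rho> > 0\<close> by (simp add: mult_le_0_iff)
  qed
qed

section \<open>Self-adjoint operators\<close>

text \<open>A maximizer \<open>v\<close> of the Rayleigh quotient on the unit sphere of
  \<open>S\<close> is an eigenvector: otherwise moving it along the residual
  \<open>w = f v - c *\<^sub>R v\<close>, which lies in \<open>S\<close> by invariance, would raise
  the quotient to first order.\<close>

lemma self_adjoint_eigenvector:
  fixes f :: "'a::euclidean_space \<Rightarrow> 'a"
  assumes f: "linear f" and sym: "\<And>u v. u \<bullet> f v = f u \<bullet> v"
    and S: "subspace S" and inv: "\<And>v. v \<in> S \<Longrightarrow> f v \<in> S" and "S \<noteq> {0}"
  shows "\<exists>v\<in>S. norm v = 1 \<and> (\<exists>c. f v = c *\<^sub>R v)"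
proof -
  interpret linear f by fact
  obtain z where z: "z \<in> S" "z \<noteq> 0" using S \<open>S \<noteq> {0}\<close> subspace_0 by blast
  have "compact (S \<inter> sphere 0 1)"
    by (simp add: S closed_Int_compact closed_subspace)
  moreover have "(1 / norm z) *\<^sub>R z \<in> S \<inter> sphere 0 1"
    using z S by (simp add: subspace_scale)
  moreover have "continuous_on (S \<inter> sphere 0 1) (\<lambda>v. v \<bullet> f v)"
    by (intro continuous_intros linear_continuous_on linear_conv_bounded_linear[THEN iffD1] f)
  ultimately obtain v where v: "v \<in> S \<inter> sphere 0 1"
    and max: "\<And>u. u \<in> S \<inter> sphere 0 1 \<Longrightarrow> u \<bullet> f u \<le> v \<bullet> f v"
    using continuous_attains_sup[of "S \<inter> sphere 0 1" "\<lambda>v. v \<bullet> f v"] by blast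
  define c where "c = v \<bullet> f v"
  define w where "w = f v - c *\<^sub>R v"
  define k where "k = c * (w \<bullet> w) - w \<bullet> f w"
  have vv: "v \<bullet> v = 1" using v by (simp add: norm_eq_1)
  have Rayleigh: "u \<bullet> f u \<le> c * (u \<bullet> u)" if "u \<in> S" for u
  proof (cases "u = 0")
    case False
    then have "(1 / norm u) *\<^sub>R u \<in> S \<inter> sphere 0 1"
      using that S by (simp add: subspace_scale)
    from max[OF this] have "(u \<bullet> f u) / (norm u)\<^sup>2 \<le> c"
      by (simp add: scale c_def power2_eq_square)
    then show ?thesis using False by (simp add: divide_le_eq power2_norm_eq_inner)
  qed (simp add: zero)
  have w: "w \<in> S" using v S inv by (simp add: w_def subspace_diff subspace_scale)
  have bound: "2 * t * (w \<bullet> w) \<le> t\<^sup>2 * k" for t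
  proof -
    have "v + t *\<^sub>R w \<in> S" using v w S by (simp add: subspace_add subspace_scale)
    from Rayleigh[OF this] have "c + 2 * t * (w \<bullet> f v) + t\<^sup>2 * (w \<bullet> f w)
        \<le> c * (1 + 2 * t * (w \<bullet> v) + t\<^sup>2 * (w \<bullet> w))"
      by (simp add: add scale inner_add_left inner_add_right vv sym[of v w] inner_commute
          power2_eq_square c_def[symmetric] algebra_simps)
    moreover have "w \<bullet> f v = w \<bullet> w + c * (w \<bullet> v)"
      by (simp add: w_def inner_diff_left inner_diff_right)
    ultimately show ?thesis by (simp add: k_def algebra_simps)
  qed
  have "w = 0"
  proof (rule ccontr)
    assume "w \<noteq> 0"
    then have pos: "w \<bullet> w > 0" by simp
    \<comment> \<open>\<open>t = 1\<close> forces \<open>k > 0\<close>; at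
      \<open>t = (w \<bullet> w) / k\<close> the linear term then exceeds the quadratic one.\<close>
    have "k > 0" using bound[of 1] pos by (simp del: inner_gt_zero_iff)
    then have "(w \<bullet> w) * (w \<bullet> w) \<le> 0"
      using bound[of "(w \<bullet> w) / k"] by (simp add: power2_eq_square field_simps)
    with mult_pos_pos[OF pos pos] show False by linarith
  qed
  then have "f v = c *\<^sub>R v" by (simp add: w_def)
  with v show ?thesis by auto
qed

text \<open>Orthonormal sets of eigenvectors are independent, so one of greatest size exists. If it
  did not span, its orthogonal complement would be a nonzero invariant subspace and would contain a
  further unit eigenvector.\<close>

lemma self_adjoint_eigenbasis:
  fixes f :: "'a::euclidean_space \<Rightarrow> 'a"
  assumes f: "linear f" and sym: "\<And>u v. u \<bullet> f v = f u \<bullet> v"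
  obtains E :: "'a set" and c :: "'a \<Rightarrow> real"
    where "finite E" "pairwise orthogonal E" "\<And>e. e \<in> E \<Longrightarrow> norm e = 1" "span E = UNIV"
      "\<And>e. e \<in> E \<Longrightarrow> f e = c e *\<^sub>R e"
proof -
  define P where "P E \<longleftrightarrow> pairwise orthogonal E \<and>
     (\<forall>e\<in>E. norm e = 1 \<and> (\<exists>c. f e = c *\<^sub>R e))" for E
  have ind: "independent E" if "P E" for E
    using that pairwise_orthogonal_independent[of E] unfolding P_def by (metis norm_zero zero_neq_one)
  have "P {}" by (simp add: P_def)
  moreover have "\<forall>E. P E \<longrightarrow> card E < Suc DIM('a)"
    using ind independent_card_le by (auto simp: less_Suc_eq_le)
  ultimately obtain E where E: "P E" and max: "\<And>E'. P E' \<Longrightarrow> card E' \<le> card E"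
    using ex_has_greatest_nat[of P "{}" card "Suc DIM('a)"] by blast
  have fin: "finite E" using ind[OF E] independent_imp_finite by blast
  have "span E = UNIV"
  proof (rule ccontr)
    assume "span E \<noteq> UNIV"
    then obtain z where z: "z \<noteq> 0" "\<And>x. x \<in> span E \<Longrightarrow> orthogonal z x"
      using span_not_UNIV_orthogonal[of E] by (auto simp: orthogonal_def)
    define S where "S = {x. \<forall>e\<in>E. x \<bullet> e = 0}"
    have "subspace S" by (auto simp: S_def subspace_def inner_add_left)
    moreover have "f v \<in> S" if "v \<in> S" for v
    proof -
      have "f v \<bullet> e = 0" if e: "e \<in> E" for e
      proof -
        obtain c where "f e = c *\<^sub>R e" using E e by (auto simp: P_def)
        then show ?thesis using e \<open>v \<in> S\<close> by (simp add: sym[symmetric] S_def)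
      qed
      then show ?thesis by (simp add: S_def)
    qed
    moreover have "z \<in> S" using z by (auto simp: S_def orthogonal_def span_base)
    ultimately obtain v c where v: "v \<in> S" "norm v = 1" "f v = c *\<^sub>R v"
      using self_adjoint_eigenvector[of f S] f sym z by blast
    then have "v \<notin> E" by (auto simp: S_def norm_eq_1)
    have "P (insert v E)"
      using E v unfolding P_def by (auto simp: pairwise_insert orthogonal_def S_def inner_commute)
    from max[OF this] show False using \<open>v \<notin> E\<close> fin by simp
  qed
  moreover obtain c where "\<And>e. e \<in> E \<Longrightarrow> f e = c e *\<^sub>R e" using E unfolding P_def by metis
  ultimately show ?thesis using that[of E c] fin E by (simp add: P_def)
qed

section \<open>Chebyshev polynomials\<close>

lemma chebyshev_T_0 [simp]: "chebyshev_T 0 = 1"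
  by (rule chebyshev_T_unique[of _ 0]) (simp_all add: poly_chebyshev_T_cos)

lemma chebyshev_T_1 [simp]: "chebyshev_T (Suc 0) = [:0, 1:]"
  by (rule chebyshev_T_unique[of _ 1]) (simp_all add: poly_chebyshev_T_cos)

lemma chebyshev_T_Suc_Suc:
  "chebyshev_T (Suc (Suc n)) = [:0, 2:] * chebyshev_T (Suc n) - chebyshev_T n"
proof (rule chebyshev_T_unique[of _ "Suc (Suc n)"])
  fix t
  have "cos (real (Suc (Suc n)) * t) = cos (real (Suc n) * t + t)"
    and "cos (real n * t) = cos (real (Suc n) * t - t)"
    by (simp_all add: algebra_simps)
  then show "poly ([:0, 2:] * chebyshev_T (Suc n) - chebyshev_T n) (cos t)
      = cos (real (Suc (Suc n)) * t)"
    by (simp only: cos_add cos_diff)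
      (simp add: poly_chebyshev_T_cos cos_diff algebra_simps)
qed (rule poly_chebyshev_T_cos)

lemma chebyshev_T_at_1 [simp]: "poly (chebyshev_T n) 1 = 1"
  using poly_chebyshev_T_cos[of n 0] by simp

lemma abs_chebyshev_T_le_1:
  assumes "\<bar>u\<bar> \<le> 1"
  shows "\<bar>poly (chebyshev_T n) u\<bar> \<le> 1"
proof -
  have "cos (arccos u) = u" using assms by simp
  then show ?thesis using poly_chebyshev_T_cos[of n "arccos u"] abs_cos_le_one by metis
qed

text \<open>Chebyshev polynomials of the second kind, U_n(cos t) = sin((n+1)t) / sin t, introduced
  to express the derivative of \<open>chebyshev_T\<close>.\<close>

fun chebyshev_U :: "nat \<Rightarrow> real \<Rightarrow> real" where
  "chebyshev_U 0 x = 1"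
| "chebyshev_U (Suc 0) x = 2 * x"
| "chebyshev_U (Suc (Suc n)) x = 2 * x * chebyshev_U (Suc n) x - chebyshev_U n x"

lemma chebyshev_T_Suc_eq_U:
  "poly (chebyshev_T (Suc n)) x = chebyshev_U (Suc n) x - x * chebyshev_U n x"
proof (induction n rule: induct_nat_012)
  case (ge2 n)
  have "poly (chebyshev_T (Suc (Suc (Suc n)))) x
      = 2 * x * poly (chebyshev_T (Suc (Suc n))) x - poly (chebyshev_T (Suc n)) x"
    by (simp add: chebyshev_T_Suc_Suc[of "Suc n"])
  also have "\<dots> = chebyshev_U (Suc (Suc (Suc n))) x - x * chebyshev_U (Suc (Suc n)) x"
    unfolding ge2 by (simp add: algebra_simps)
  finally show ?case .
qed (simp_all add: chebyshev_T_Suc_Suc)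

text \<open>Unrolled down to index 0 or 1, this writes \<open>chebyshev_U\<close> as a sum of
  \<open>chebyshev_T\<close> with nonnegative coefficients, so comparisons for T pass to U.\<close>

lemma chebyshev_U_Suc_Suc_eq_T:
  "chebyshev_U (Suc (Suc n)) x = chebyshev_U n x + 2 * poly (chebyshev_T (Suc (Suc n))) x"
  unfolding chebyshev_T_Suc_eq_U by (simp add: algebra_simps)

lemma pderiv_chebyshev_T:
  "poly (pderiv (chebyshev_T (Suc n))) x = real (Suc n) * chebyshev_U n x"
proof (induction n x rule: chebyshev_U.induct)
  case (3 n x)
  have "poly (pderiv (chebyshev_T (Suc (Suc (Suc n))))) x =
      2 * poly (chebyshev_T (Suc (Suc n))) x
      + 2 * x * poly (pderiv (chebyshev_T (Suc (Suc n)))) x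
      - poly (pderiv (chebyshev_T (Suc n))) x"
    by (simp add: chebyshev_T_Suc_Suc[of "Suc n"] pderiv_diff pderiv_mult pderiv_pCons pderiv_smult)
  also have "\<dots> = real (Suc (Suc (Suc n))) * chebyshev_U (Suc (Suc n)) x"
    unfolding 3 chebyshev_T_Suc_eq_U by (simp add: algebra_simps)
  finally show ?case .
qed (simp_all add: pderiv_pCons chebyshev_T_Suc_Suc pderiv_diff pderiv_mult)

lemma chebyshev_U_ge_1:
  assumes "x \<ge> 1"
  shows "chebyshev_U n x \<ge> 1"
proof -
  \<comment> \<open>Monotonicity in \<open>n\<close> is what carries the induction: it gives 2
    U_{n+1} - U_n \<ge> U_{n+1}.\<close>
  have "chebyshev_U n x \<ge> 1 \<and> chebyshev_U n x \<le> chebyshev_U (Suc n) x"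
  proof (induction n)
    case (Suc n)
    have "(2 * x) * chebyshev_U (Suc n) x \<ge> 2 * chebyshev_U (Suc n) x"
      using Suc assms by (intro mult_right_mono) auto
    then show ?case using Suc unfolding chebyshev_U.simps by linarith
  qed (use assms in simp)
  then show ?thesis ..
qed

lemma chebyshev_T_strict_mono:
  assumes "1 \<le> u" "u < x"
  shows "poly (chebyshev_T (Suc n)) u < poly (chebyshev_T (Suc n)) x"
proof (rule DERIV_pos_imp_increasing[OF assms(2)])
  fix z assume "u \<le> z" "z \<le> x"
  then have "chebyshev_U n z \<ge> 1" using chebyshev_U_ge_1 assms by force
  then have "poly (pderiv (chebyshev_T (Suc n))) z > 0" by (simp add: pderiv_chebyshev_T)
  then show "\<exists>y. DERIV (poly (chebyshev_T (Suc n))) z :> y \<and> 0 < y" using poly_DERIV by blast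
qed

text \<open>On [-1, 1] the polynomial oscillates but never exceeds 1, its value at 1; to the right
  of 1 it does not decrease.\<close>

lemma chebyshev_T_le:
  assumes "-1 \<le> u" "u \<le> x" "1 \<le> x"
  shows "poly (chebyshev_T n) u \<le> poly (chebyshev_T n) x"
proof (cases n)
  case (Suc k)
  have mono: "poly (chebyshev_T n) v \<le> poly (chebyshev_T n) x" if "1 \<le> v" "v \<le> x" for v
    using chebyshev_T_strict_mono[of v x k] that by (cases "v = x") (auto simp: Suc)
  show ?thesis
  proof (cases "u \<le> 1")
    case True
    then show ?thesis using abs_chebyshev_T_le_1[of u n] mono[of 1] assms by (auto simp: abs_le_iff)
  qed (use mono assms in auto)
qed simp

lemma chebyshev_U_le:
  assumes "-1 \<le> u" "u \<le> x" "1 \<le> x"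
  shows "chebyshev_U n u \<le> chebyshev_U n x"
proof (induction n rule: induct_nat_012)
  case (ge2 n)
  then show ?case unfolding chebyshev_U_Suc_Suc_eq_T
    using chebyshev_T_le[OF assms] by (intro add_mono mult_left_mono) auto
qed (use assms in auto)

text \<open>Since \<open>U\<^sub>n\<close> is a nonnegative combination of the \<open>T\<^sub>k\<close>, the derivative \<open>n U\<^sub>n\<^sub>-\<^sub>1\<close> is largest at
  the right end of \<open>[-1, x]\<close> when \<open>x \<ge> 1\<close>, although \<open>T\<^sub>n\<close> is not convex there.\<close>

lemma chebyshev_T_tangent:
  assumes "-1 \<le> u" "u \<le> x" "1 \<le> x"
  shows "poly (chebyshev_T n) x - poly (chebyshev_T n) u \<le> (x - u) * poly (pderiv (chebyshev_T n)) x"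
proof (cases "u < x")
  case True
  then obtain z where z: "u < z" "z < x"
    "poly (chebyshev_T n) x - poly (chebyshev_T n) u = (x - u) * poly (pderiv (chebyshev_T n)) z"
    using poly_MVT by blast
  have "poly (pderiv (chebyshev_T n)) z \<le> poly (pderiv (chebyshev_T n)) x"
  proof (cases n)
    case (Suc k)
    then show ?thesis using z assms chebyshev_U_le[of z x k]
      by (simp only: pderiv_chebyshev_T) (intro mult_left_mono; simp)
  qed simp
  then show ?thesis using z True by simp
qed (use assms in simp)

section \<open>Smooth convex functions\<close>

text \<open>Descent lemma: along the segment from \<open>y\<close> to \<open>u\<close>,
  \<open>g\<close> minus the claimed bound has nonpositive derivative, by Cauchy-Schwarz and the
  Lipschitz gradient.\<close>

lemma beta_smooth_upper:
  assumes "beta_smooth \<beta> g"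
  shows "g u \<le> g y + gradient g y \<bullet> (u - y) + \<beta> / 2 * (norm (u - y))\<^sup>2"
proof -
  define d where "d = u - y"
  define \<phi> where "\<phi> t = g (y + t *\<^sub>R d) - t * (gradient g y \<bullet> d) - \<beta> / 2 * t\<^sup>2 * (norm d)\<^sup>2" for t :: real
  have "\<phi> 1 \<le> \<phi> 0"
  proof (rule DERIV_nonpos_imp_nonincreasing[of 0 1 \<phi>])
    fix t :: real assume "0 \<le> t" "t \<le> 1"
    define G where "G = gradient g (y + t *\<^sub>R d)"
    have [derivative_intros]: "((\<lambda>t. g (y + t *\<^sub>R d)) has_real_derivative (d \<bullet> G)) (at t)"
    proof -
      have "(g has_derivative (\<lambda>v. v \<bullet> G)) (at (y + t *\<^sub>R d))"
        using assms GDERIV_gradient unfolding beta_smooth_def gderiv_def G_def by blast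
      moreover have "((\<lambda>t. y + t *\<^sub>R d) has_derivative (\<lambda>r. r *\<^sub>R d)) (at t)"
        by (auto intro!: derivative_eq_intros)
      ultimately have "((\<lambda>t. g (y + t *\<^sub>R d)) has_derivative (\<lambda>r. (r *\<^sub>R d) \<bullet> G)) (at t)"
        by (rule has_derivative_compose[rotated])
      then show ?thesis by (simp add: has_field_derivative_def mult_commute_abs)
    qed
    have "(\<phi> has_real_derivative (d \<bullet> G - gradient g y \<bullet> d - \<beta> * t * (norm d)\<^sup>2)) (at t)"
      unfolding \<phi>_def by (auto intro!: derivative_eq_intros)
    moreover have "d \<bullet> G - gradient g y \<bullet> d - \<beta> * t * (norm d)\<^sup>2 \<le> 0"
    proof -
      have "dist G (gradient g y) \<le> \<beta> * dist (y + t *\<^sub>R d) y"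
        using assms unfolding beta_smooth_def G_def by (meson UNIV_I lipschitz_onD)
      then have "norm (G - gradient g y) \<le> \<beta> * t * norm d"
        using \<open>0 \<le> t\<close> by (simp add: dist_norm)
      then have "(G - gradient g y) \<bullet> d \<le> \<beta> * t * norm d * norm d"
        by (meson norm_cauchy_schwarz mult_right_mono norm_ge_zero order_trans)
      then show ?thesis by (simp add: inner_diff_left inner_commute[of d] power2_eq_square mult.assoc)
    qed
    ultimately show "\<exists>z. DERIV \<phi> t :> z \<and> z \<le> 0" by blast
  qed simp
  then show ?thesis by (simp add: \<phi>_def d_def)
qed

text \<open>Restriction to the line through \<open>y\<close> and \<open>u\<close> reduces this to
  the tangent inequality in one real variable.\<close>

lemma convex_gradient_lower:
  assumes "convex_on UNIV g" "g differentiable (at y)"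
  shows "g y + gradient g y \<bullet> (u - y) \<le> g u"
proof -
  define d where "d = u - y"
  define \<phi> where "\<phi> t = g (y + t *\<^sub>R d)" for t :: real
  have "convex_on UNIV \<phi>"
  proof (rule convex_onI)
    fix t p q :: real assume t: "0 < t" "t < 1"
    have "\<phi> ((1 - t) *\<^sub>R p + t *\<^sub>R q) = g ((1 - t) *\<^sub>R (y + p *\<^sub>R d) + t *\<^sub>R (y + q *\<^sub>R d))"
      by (simp add: \<phi>_def algebra_simps)
    also have "\<dots> \<le> (1 - t) * \<phi> p + t * \<phi> q"
      unfolding \<phi>_def using convex_onD[OF assms(1), of t] t by simp
    finally show "\<phi> ((1 - t) *\<^sub>R p + t *\<^sub>R q) \<le> (1 - t) * \<phi> p + t * \<phi> q" .
  qed simp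
  moreover have "(\<phi> has_real_derivative (d \<bullet> gradient g y)) (at 0)"
  proof -
    have "(g has_derivative (\<lambda>v. v \<bullet> gradient g y)) (at (y + 0 *\<^sub>R d))"
      using assms GDERIV_gradient unfolding gderiv_def by simp
    moreover have "((\<lambda>t. y + t *\<^sub>R d) has_derivative (\<lambda>r. r *\<^sub>R d)) (at 0)"
      by (auto intro!: derivative_eq_intros)
    ultimately have "(\<phi> has_derivative (\<lambda>r. (r *\<^sub>R d) \<bullet> gradient g y)) (at 0)"
      unfolding \<phi>_def by (rule has_derivative_compose[rotated])
    then show ?thesis by (simp add: has_field_derivative_def mult_commute_abs)
  qed
  ultimately have "\<phi> 1 - \<phi> 0 \<ge> (d \<bullet> gradient g y) * (1 - 0)"
    by (intro convex_on_imp_above_tangent[of UNIV]) auto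
  then show ?thesis by (simp add: \<phi>_def d_def inner_commute)
qed

section \<open>Preconditioned gradient steps\<close>

lemma orthonormal_inner_sum:
  assumes "pairwise orthogonal E" "\<And>e. e \<in> E \<Longrightarrow> norm e = 1" "finite E" "e \<in> E"
  shows "(\<Sum>i\<in>E. k i *\<^sub>R i) \<bullet> e = k e"
proof -
  have "k i * (i \<bullet> e) = (if i = e then k e else 0)" if "i \<in> E" for i
    using assms that by (auto simp: pairwise_def orthogonal_def norm_eq_1)
  then have "(\<Sum>i\<in>E. k i *\<^sub>R i) \<bullet> e = (\<Sum>i\<in>E. if i = e then k e else 0)"
    by (simp add: inner_sum_left cong: sum.cong)
  then show ?thesis using assms by simp
qed

lemma orthonormal_Parseval:
  assumes "pairwise orthogonal E" "\<And>e. e \<in> E \<Longrightarrow> norm e = 1" "finite E" "span E = UNIV"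
  shows "x \<bullet> y = (\<Sum>e\<in>E. (x \<bullet> e) * (y \<bullet> e))"
proof -
  have "x = (\<Sum>e\<in>E. (x \<bullet> e) *\<^sub>R e)" using orthonormal_basis_expand[of E x] assms by simp
  then have "x \<bullet> y = (\<Sum>e\<in>E. (x \<bullet> e) *\<^sub>R e) \<bullet> y" by simp
  then show ?thesis by (simp add: inner_sum_left inner_commute[of y])
qed

text \<open>The \<open>a e\<close> are the eigenvalues of the preconditioner. After the change of
  variable the quadratic part has eigenvalues \<open>c e * a e\<close> within \<alpha> of 1, and
  \<open>g\<close> adds curvature between 0 and \<open>h * \<beta>\<close>. Thus
  \<open>\<alpha> \<le> \<rho>\<close> yields the lower quadratic bound and
  \<open>\<alpha> + h * \<beta> \<le> \<rho>\<close> the upper one.\<close>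

lemma preconditioned_step_contraction:
  fixes T :: "'a::euclidean_space \<Rightarrow> 'a"
  assumes T: "linear T" "\<And>u v. u \<bullet> T v = T u \<bullet> v"
    and E: "pairwise orthogonal E" "\<And>e. e \<in> E \<Longrightarrow> norm e = 1" "finite E" "span E = UNIV"
    and c: "\<And>e. e \<in> E \<Longrightarrow> T e = c e *\<^sub>R e"
    and a: "\<And>e. e \<in> E \<Longrightarrow> 0 < a e" "\<And>e. e \<in> E \<Longrightarrow> a e \<le> h"
    and ca: "\<And>e. e \<in> E \<Longrightarrow> \<bar>1 - c e * a e\<bar> \<le> \<alpha>"
    and g: "beta_smooth \<beta> g" "convex_on UNIV g" "0 \<le> \<beta>"
    and \<rho>: "0 < \<rho>" "\<alpha> \<le> \<rho>" "\<alpha> + h * \<beta> \<le> \<rho>"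
    and f: "\<And>z. f z = 1 / 2 * (z \<bullet> T z) + g z"
    and xs: "\<And>z. f xs \<le> f z"
    and x': "\<And>e. e \<in> E \<Longrightarrow> x' \<bullet> e = x \<bullet> e - a e * ((T x + gradient g x) \<bullet> e)"
  shows "f x' - f xs \<le> \<rho>\<^sup>2 * (f x - f xs)"
proof -
  interpret T: linear T by fact
  note Parseval = orthonormal_Parseval[OF E]
  have eqI: "u = v" if "\<And>e. e \<in> E \<Longrightarrow> u \<bullet> e = v \<bullet> e" for u v :: 'a
    using that vector_eq_dot_span[of u E v] E(4) by (simp add: inner_commute)
  \<comment> \<open>\<open>D\<close> is \<open>B\<^sup>1\<^sup>/\<^sup>2\<close> for the preconditioner \<open>B\<close> with eigenvalues \<open>a e\<close>, and \<open>D'\<close> its inverse.\<close>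
  define D where "D v = (\<Sum>e\<in>E. (sqrt (a e) * (v \<bullet> e)) *\<^sub>R e)" for v
  define D' where "D' v = (\<Sum>e\<in>E. (v \<bullet> e / sqrt (a e)) *\<^sub>R e)" for v
  \<comment> \<open>The gradient of \<open>\<lambda>v. f (D v)\<close>; the outer \<open>D\<close>
    is the adjoint of the inner one.\<close>
  define G where "G v = D (T (D v) + gradient g (D v))" for v
  have D: "D v \<bullet> e = sqrt (a e) * (v \<bullet> e)" if "e \<in> E" for e v
    unfolding D_def using orthonormal_inner_sum[OF E(1-3) that] by simp
  have D': "D' v \<bullet> e = v \<bullet> e / sqrt (a e)" if "e \<in> E" for e v
    unfolding D'_def using orthonormal_inner_sum[OF E(1-3) that] by simp
  have DD': "D (D' v) = v" for v
    using a(1) by (intro eqI) (simp add: D D' less_imp_neq[symmetric])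
  have D_diff: "D (u - v) = D u - D v" for u v
    by (intro eqI) (simp add: D inner_diff_left algebra_simps)
  have D_adj: "D u \<bullet> v = u \<bullet> D v" for u v
  proof -
    have "D u \<bullet> v = (\<Sum>e\<in>E. (D u \<bullet> e) * (v \<bullet> e))" by (rule Parseval)
    also have "\<dots> = (\<Sum>e\<in>E. (u \<bullet> e) * (D v \<bullet> e))" by (intro sum.cong) (simp_all add: D)
    also have "\<dots> = u \<bullet> D v" by (rule Parseval[symmetric])
    finally show ?thesis .
  qed
  have T_e: "T v \<bullet> e = c e * (v \<bullet> e)" if "e \<in> E" for e v
    using T(2)[of v e] c[OF that] by simp
  have quad: "D d \<bullet> T (D d) = (\<Sum>e\<in>E. c e * a e * (d \<bullet> e)\<^sup>2)" for d
  proof -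
    have "D d \<bullet> T (D d) = (\<Sum>e\<in>E. (D d \<bullet> e) * (T (D d) \<bullet> e))" by (rule Parseval)
    also have "\<dots> = (\<Sum>e\<in>E. c e * (sqrt (a e) * sqrt (a e)) * (d \<bullet> e)\<^sup>2)"
      by (intro sum.cong) (simp_all add: D T_e power2_eq_square mult_ac)
    also have "\<dots> = (\<Sum>e\<in>E. c e * a e * (d \<bullet> e)\<^sup>2)"
      using a(1) by (intro sum.cong) (simp_all add: less_imp_le)
    finally show ?thesis .
  qed
  have norm_sq: "(norm v)\<^sup>2 = (\<Sum>e\<in>E. (v \<bullet> e)\<^sup>2)" for v :: 'a
    by (simp only: power2_norm_eq_inner Parseval[of v v]) (simp only: power2_eq_square)
  have norm_D: "(norm (D d))\<^sup>2 \<le> h * (norm d)\<^sup>2" for d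
  proof -
    have "(norm (D d))\<^sup>2 = (\<Sum>e\<in>E. a e * (d \<bullet> e)\<^sup>2)"
      unfolding norm_sq using a(1) by (intro sum.cong) (auto simp: D power_mult_distrib less_imp_le)
    also have "\<dots> \<le> (\<Sum>e\<in>E. h * (d \<bullet> e)\<^sup>2)"
      using a(2) by (intro sum_mono mult_right_mono) auto
    finally show ?thesis by (simp add: norm_sq sum_distrib_left)
  qed
  have ca_bounds: "1 - \<alpha> \<le> c e * a e" "c e * a e \<le> 1 + \<alpha>" if "e \<in> E" for e
    using ca[OF that] by (simp_all add: abs_le_iff)
  have quad_lower: "(1 - \<alpha>) * (norm d)\<^sup>2 \<le> D d \<bullet> T (D d)" for d
    unfolding quad norm_sq sum_distrib_left using ca_bounds
    by (intro sum_mono mult_right_mono) auto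
  have quad_upper: "D d \<bullet> T (D d) \<le> (1 + \<alpha>) * (norm d)\<^sup>2" for d
    unfolding quad norm_sq sum_distrib_left using ca_bounds
    by (intro sum_mono mult_right_mono) auto
  have G_inner: "G y \<bullet> d = (T (D y) + gradient g (D y)) \<bullet> D d" for y d
    by (simp only: G_def D_adj)
  \<comment> \<open>The quadratic part is expanded exactly. The last bracket is the remainder of
    \<open>g\<close>, bounded below by convexity and above by smoothness.\<close>
  have expand: "f (D u) = f (D y) + G y \<bullet> (u - y) + 1 / 2 * (D (u - y) \<bullet> T (D (u - y)))
      + (g (D u) - g (D y) - gradient g (D y) \<bullet> D (u - y))" for u y
    unfolding f G_inner D_diff T.diff
    by (simp add: inner_diff_left inner_diff_right inner_add_left T(2)[of "D y" "D u"]
        inner_commute[of "D u"] T(2)[of "D y" "D y"] algebra_simps)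
  have "f (D (D' x - G (D' x))) - f (D (D' xs)) \<le> \<rho>\<^sup>2 * (f (D (D' x)) - f (D (D' xs)))"
  proof (rule gradient_step_contraction[of \<rho> "\<lambda>v. f (D v)" G])
    fix u y :: 'a
    have "(1 - \<rho>) * (norm (u - y))\<^sup>2 \<le> (1 - \<alpha>) * (norm (u - y))\<^sup>2"
      using \<rho> by (intro mult_right_mono) auto
    moreover have "g (D y) + gradient g (D y) \<bullet> D (u - y) \<le> g (D u)"
      unfolding D_diff using g convex_gradient_lower unfolding beta_smooth_def by blast
    ultimately show "f (D y) + G y \<bullet> (u - y) + (1 - \<rho>) / 2 * (norm (u - y))\<^sup>2 \<le> f (D u)"
      using expand[of u y] quad_lower[of "u - y"] by simp
    have "g (D u) \<le> g (D y) + gradient g (D y) \<bullet> D (u - y) + \<beta> / 2 * (norm (D (u - y)))\<^sup>2"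
      unfolding D_diff by (rule beta_smooth_upper[OF g(1)])
    moreover have "\<beta> / 2 * (norm (D (u - y)))\<^sup>2 \<le> \<beta> / 2 * (h * (norm (u - y))\<^sup>2)"
      using g(3) norm_D by (intro mult_left_mono) auto
    moreover have "(1 + \<alpha> + h * \<beta>) * (norm (u - y))\<^sup>2 \<le> (1 + \<rho>) * (norm (u - y))\<^sup>2"
      using \<rho> by (intro mult_right_mono) auto
    ultimately show "f (D u) \<le> f (D y) + G y \<bullet> (u - y) + (1 + \<rho>) / 2 * (norm (u - y))\<^sup>2"
      using expand[of u y] quad_upper[of "u - y"] by (simp add: add_divide_distrib algebra_simps)
  qed (use \<rho> xs DD' in auto)
  \<comment> \<open>\<open>D\<close> applied twice scales the coordinate along \<open>e\<close> by
    \<open>a e\<close>, so the unit step from \<open>D' x\<close> is carried to the preconditioned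
    step from \<open>x\<close>.\<close>
  moreover have "D (D' x - G (D' x)) = x'"
    using a(1) by (intro eqI) (simp add: D_diff DD' G_def D x' inner_diff_left less_imp_le
        flip: mult.assoc)
  ultimately show ?thesis by (simp add: DD')
qed

section \<open>The method PRKCD\<close>

text \<open>With the gradient of \<open>g\<close> frozen at \<open>x\<close>, the component along
  \<open>e\<close> obeys a scalar three-term recursion with constant forcing. Its coefficients are
  those of the Chebyshev recursion at \<open>\<omega>\<^sub>0 - \<omega>\<^sub>1 * h * c\<close>,
  normalized by the values at \<open>\<omega>\<^sub>0\<close>.\<close>

lemma prkcd_stage_eigenvector:
  fixes A :: "real ^ 'd ^ 'd"
  assumes sym: "\<And>u v. u \<bullet> (A *v v) = (A *v u) \<bullet> v"
    and e: "A *v e = c *\<^sub>R e" "c \<noteq> 0"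
    and \<omega>\<^sub>0: "\<And>j. poly (chebyshev_T j) \<omega>\<^sub>0 > 0"
  shows "prkcd_stage A g h \<omega>\<^sub>0 \<omega>\<^sub>1 x j \<bullet> e = x \<bullet> e -
    (1 - poly (chebyshev_T j) (\<omega>\<^sub>0 - \<omega>\<^sub>1 * h * c) / poly (chebyshev_T j) \<omega>\<^sub>0) / c *
    ((A *v x + gradient g x) \<bullet> e)"
proof -
  have Ae: "(A *v v) \<bullet> e = c * (v \<bullet> e)" for v using sym[of v e] e by simp
  show ?thesis
  proof (induction j rule: induct_nat_012)
    \<comment> \<open>The recursion starts from T_1(u) = u, without the factor 2 of later stages;
      this matches the halved first coefficient
      \<open>\<omega>\<^sub>1 / \<omega>\<^sub>0\<close>.\<close>
    case 1
    have "\<omega>\<^sub>0 > 0" using \<omega>\<^sub>0[of 1] by simp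
    then have "(1 - poly (chebyshev_T (Suc 0)) (\<omega>\<^sub>0 - \<omega>\<^sub>1 * h * c) / poly (chebyshev_T (Suc 0)) \<omega>\<^sub>0) / c
        = h * (\<omega>\<^sub>1 / \<omega>\<^sub>0)"
      using e(2) by (simp add: field_simps)
    then show ?case by (simp only: prkcd_stage.simps inner_diff_left inner_scaleR_left)
  next
    case (ge2 j)
    define X where "X i = prkcd_stage A g h \<omega>\<^sub>0 \<omega>\<^sub>1 x i \<bullet> e" for i
    define t where "t i = poly (chebyshev_T i) \<omega>\<^sub>0" for i
    define p where "p i = poly (chebyshev_T i) (\<omega>\<^sub>0 - \<omega>\<^sub>1 * h * c) / t i" for i
    define \<mu> \<nu> where "\<mu> = rkc_mu \<omega>\<^sub>0 \<omega>\<^sub>1 (Suc (Suc j))" and "\<nu> = rkc_nu \<omega>\<^sub>0 (Suc (Suc j))"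
    define w where "w = (A *v x + gradient g x) \<bullet> e"
    have t: "t i > 0" for i using \<omega>\<^sub>0 by (simp add: t_def)
    have t2: "t (Suc (Suc j)) = 2 * \<omega>\<^sub>0 * t (Suc j) - t j"
      by (simp add: t_def chebyshev_T_Suc_Suc)
    \<comment> \<open>The Chebyshev recursion at the shifted point, divided by
      \<open>t (Suc (Suc j))\<close>; the recursion at \<open>\<omega>\<^sub>0\<close> identifies
      \<open>\<nu> - 1\<close> as \<open>t j / t (Suc (Suc j))\<close>.\<close>
    have p2: "p (Suc (Suc j)) = (\<nu> - \<mu> * h * c) * p (Suc j) - (\<nu> - 1) * p j"
    proof -
      have \<nu>1: "\<nu> - 1 = t j / t (Suc (Suc j))"
        using t[of "Suc (Suc j)"] t2 by (simp add: \<nu>_def rkc_nu_def t_def[symmetric] field_simps)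
      have "\<nu> - \<mu> * h * c = 2 * (\<omega>\<^sub>0 - \<omega>\<^sub>1 * h * c) * t (Suc j) / t (Suc (Suc j))"
        by (simp add: \<nu>_def \<mu>_def rkc_mu_def rkc_nu_def t_def[symmetric] diff_divide_distrib
            algebra_simps)
      then show ?thesis unfolding \<nu>1 using t[of j] t[of "Suc j"]
        by (simp add: p_def chebyshev_T_Suc_Suc diff_divide_distrib)
    qed
    have IH: "X i = x \<bullet> e - (1 - p i) / c * w" if "i = j \<or> i = Suc j" for i
      using that ge2 by (auto simp: X_def p_def t_def w_def)
    \<comment> \<open>The gradient component with the part of \<open>g\<close> frozen is the initial
      one times \<open>p (Suc j)\<close>, which turns the stage update into
      \<open>p2\<close>.\<close>
    have residual: "c * X (Suc j) + gradient g x \<bullet> e = p (Suc j) * w"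
      using e(2) by (simp add: IH w_def inner_add_left Ae field_simps)
    have "X (Suc (Suc j)) = - (\<mu> * h * (c * X (Suc j) + gradient g x \<bullet> e))
        + \<nu> * X (Suc j) - (\<nu> - 1) * X j"
      by (simp add: X_def \<mu>_def \<nu>_def inner_diff_left inner_add_left Ae)
    also have "\<dots> = x \<bullet> e - (1 - p (Suc (Suc j))) / c * w"
      unfolding residual p2 using e(2) by (simp add: IH field_simps)
    finally show ?case by (simp add: X_def p_def t_def w_def)
  qed simp
qed

theorem proposition3:
  fixes A :: "real ^ 'd ^ 'd"
    and g f :: "real ^ 'd \<Rightarrow> real"
    and L l \<kappa> \<eta> \<omega>\<^sub>0 \<omega>\<^sub>1 h \<alpha> C \<beta> \<gamma> :: real
    and s :: nat
    and x :: "nat \<Rightarrow> real ^ 'd"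
    and xstar :: "real ^ 'd"
  assumes A: "symmetric_pos_def A"
    and L: "L \<in> eigenvalues A" "\<forall>c \<in> eigenvalues A. c \<le> L"
    and l: "l \<in> eigenvalues A" "\<forall>c \<in> eigenvalues A. l \<le> c" "l > 0"
    and kappa: "\<kappa> = L / l" "\<kappa> > 1"
    and eta: "\<eta> > 0"
    and s: "s = nat \<lceil>sqrt ((\<kappa> - 1) * \<eta> / 2)\<rceil>"
    and omega0: "\<omega>\<^sub>0 = 1 + \<eta> / (real s)\<^sup>2"
    and omega1: "\<omega>\<^sub>1 = poly (chebyshev_T s) \<omega>\<^sub>0 / poly (pderiv (chebyshev_T s)) \<omega>\<^sub>0"
    and h: "h = (\<omega>\<^sub>0 - 1) / (\<omega>\<^sub>1 * l)"
    and alpha: "\<alpha> = 1 / poly (chebyshev_T s) \<omega>\<^sub>0"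
    and C: "C = \<omega>\<^sub>1 * \<alpha> / (\<omega>\<^sub>0 - 1)"
    and gamma: "\<gamma> > 0"
    and g: "beta_smooth \<beta> g" "convex_on UNIV g"
    and beta: "0 < \<beta>" "\<beta> < C * \<gamma> * l"
    and f: "f = (\<lambda>y. 1 / 2 * (y \<bullet> (A *v y)) + g y)"
    and xstar: "\<forall>y. f xstar \<le> f y"
    and iter: "\<forall>n. x (Suc n) = prkcd_step A g s h \<omega>\<^sub>0 \<omega>\<^sub>1 (x n)"
  shows "\<forall>n. f (x (Suc n)) - f xstar \<le> (1 + \<gamma>)\<^sup>2 * \<alpha>\<^sup>2 * (f (x n) - f xstar)"
proof
  fix n
  have "(\<kappa> - 1) * \<eta> / 2 > 0" using kappa eta by simp
  then have "sqrt ((\<kappa> - 1) * \<eta> / 2) > 0" by simp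
  then have s_pos: "s > 0" and "sqrt ((\<kappa> - 1) * \<eta> / 2) \<le> real s"
    unfolding s by linarith+
  \<comment> \<open>Equivalent to \<open>(\<omega>\<^sub>0 - 1) * (\<kappa> - 1) \<le> 2\<close>;
    this is what the choice of \<open>s\<close> is for.\<close>
  then have s_sq: "(\<kappa> - 1) * \<eta> / 2 \<le> (real s)\<^sup>2"
    using sqrt_le_D by blast
  then obtain k where k: "s = Suc k" using s_pos gr0_conv_Suc by blast
  have \<omega>\<^sub>0: "\<omega>\<^sub>0 > 1" using eta s_pos by (simp add: omega0)
  have T_pos: "poly (chebyshev_T j) \<omega>\<^sub>0 > 0" for j
    using chebyshev_T_le[of 1 \<omega>\<^sub>0 j] \<omega>\<^sub>0 by simp
  have T_gt_1: "poly (chebyshev_T s) \<omega>\<^sub>0 > 1"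
    using chebyshev_T_strict_mono[of 1 \<omega>\<^sub>0 k] \<omega>\<^sub>0 by (simp add: k)
  have T'_pos: "poly (pderiv (chebyshev_T s)) \<omega>\<^sub>0 > 0"
    using chebyshev_U_ge_1[of \<omega>\<^sub>0 k] \<omega>\<^sub>0 by (simp add: k pderiv_chebyshev_T)
  have \<omega>\<^sub>1: "\<omega>\<^sub>1 > 0" unfolding omega1 using T_pos T'_pos by simp
  have h_pos: "h > 0" unfolding h using \<omega>\<^sub>0 \<omega>\<^sub>1 l by simp
  have \<alpha>: "0 < \<alpha>" "\<alpha> < 1" unfolding alpha using T_gt_1 by simp_all
  have \<omega>h: "\<omega>\<^sub>1 * h = (\<omega>\<^sub>0 - 1) / l" unfolding h using \<omega>\<^sub>1 by simp
  \<comment> \<open>\<open>C\<close> is scaled so that \<open>h * C * l = \<alpha>\<close>.\<close>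
  have h\<beta>: "h * \<beta> \<le> \<alpha> * \<gamma>"
  proof -
    have "h * \<beta> \<le> h * (C * \<gamma> * l)" using beta h_pos by simp
    also have "\<dots> = \<alpha> * \<gamma>" unfolding C h using \<omega>\<^sub>0 \<omega>\<^sub>1 l by simp
    finally show ?thesis .
  qed
  have sym: "u \<bullet> (A *v v) = (A *v u) \<bullet> v" for u v
    using A dot_lmul_matrix[of u A v] vector_transpose_matrix[of u A]
    by (simp add: symmetric_pos_def_def)
  obtain E c where E: "finite E" "pairwise orthogonal E" "\<And>e. e \<in> E \<Longrightarrow> norm e = 1" "span E = UNIV"
    and c: "\<And>e. e \<in> E \<Longrightarrow> A *v e = c e *\<^sub>R e"
    using self_adjoint_eigenbasis[of "(*v) A"] sym by blast
  have c_bounds: "l \<le> c e" "c e \<le> L" if "e \<in> E" for e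
  proof -
    have "c e \<in> eigenvalues A" using c[OF that] E(3)[OF that] by (auto simp: eigenvalues_def intro!: exI[of _ e])
    then show "l \<le> c e" "c e \<le> L" using L l by blast+
  qed
  \<comment> \<open>This affine map of the spectrum sends \<open>l\<close> to 1 and \<open>L\<close>
    to \<open>1 - (\<omega>\<^sub>0 - 1) * (\<kappa> - 1)\<close>, which is at least -1.\<close>
  define z where "z e = \<omega>\<^sub>0 - \<omega>\<^sub>1 * h * c e" for e
  define p where "p e = poly (chebyshev_T s) (z e) / poly (chebyshev_T s) \<omega>\<^sub>0" for e
  have z: "\<bar>z e\<bar> \<le> 1" if "e \<in> E" for e
  proof -
    have "\<omega>\<^sub>1 * h * c e \<ge> (\<omega>\<^sub>0 - 1) / l * l"
      unfolding \<omega>h using \<omega>\<^sub>0 l c_bounds[OF that] by (intro mult_left_mono) auto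
    moreover have "\<omega>\<^sub>1 * h * c e \<le> (\<omega>\<^sub>0 - 1) / l * L"
      unfolding \<omega>h using \<omega>\<^sub>0 l c_bounds[OF that] by (intro mult_left_mono) auto
    moreover have "(\<omega>\<^sub>0 - 1) / l * L = (\<omega>\<^sub>0 - 1) * (\<kappa> - 1) + (\<omega>\<^sub>0 - 1)"
      by (simp add: kappa algebra_simps)
    moreover have "(\<omega>\<^sub>0 - 1) * (\<kappa> - 1) \<le> 2"
      using s_sq s_pos by (simp add: omega0 field_simps)
    ultimately show ?thesis using l by (simp add: z_def abs_le_iff)
  qed
  have p: "\<bar>p e\<bar> \<le> \<alpha>" if "e \<in> E" for e
    using abs_chebyshev_T_le_1[OF z[OF that], of s] T_pos[of s]
    by (simp add: p_def alpha divide_right_mono)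
  \<comment> \<open>Since \<open>\<omega>\<^sub>1\<close> is the ratio of T_s to its derivative at
    \<open>\<omega>\<^sub>0\<close>, the tangent bound becomes exactly \<open>h * c e\<close> after
    division by T_s there.\<close>
  have p_tangent: "(1 - p e) / c e \<le> h" if "e \<in> E" for e
  proof -
    have "poly (chebyshev_T s) \<omega>\<^sub>0 - poly (chebyshev_T s) (z e)
        \<le> (\<omega>\<^sub>0 - z e) * poly (pderiv (chebyshev_T s)) \<omega>\<^sub>0"
      using z[OF that] \<omega>\<^sub>0 by (intro chebyshev_T_tangent) auto
    also have "\<dots> = h * c e * poly (chebyshev_T s) \<omega>\<^sub>0"
      using T'_pos by (simp add: z_def omega1)
    finally have "1 - p e \<le> h * c e"
      using T_pos[of s] by (simp add: p_def field_simps)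
    then show ?thesis using c_bounds[OF that] l by (simp add: divide_le_eq)
  qed
  \<comment> \<open>Here \<rho> is \<open>\<alpha> * (1 + \<gamma>)\<close>, which is at least
    \<open>\<alpha> + h * \<beta>\<close>. With \<open>a e = (1 - p e) / c e\<close> the deviation
    \<open>1 - c e * a e\<close> is \<open>p e\<close>.\<close>
  have "f (x (Suc n)) - f xstar \<le> (\<alpha> * (1 + \<gamma>))\<^sup>2 * (f (x n) - f xstar)"
  proof (rule preconditioned_step_contraction[where T = "(*v) A" and E = E and c = c and \<alpha> = \<alpha>
        and a = "\<lambda>e. (1 - p e) / c e" and h = h and \<beta> = \<beta> and g = g])
    fix e assume e: "e \<in> E"
    have ce: "c e > 0" using c_bounds[OF e] l by simp
    show "A *v e = c e *\<^sub>R e" using c e by blast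
    show "0 < (1 - p e) / c e" using p[OF e] \<alpha> ce by (simp add: abs_le_iff)
    show "(1 - p e) / c e \<le> h" using p_tangent e .
    show "\<bar>1 - c e * ((1 - p e) / c e)\<bar> \<le> \<alpha>" using p[OF e] ce by simp
    show "x (Suc n) \<bullet> e = x n \<bullet> e - (1 - p e) / c e * ((A *v x n + gradient g (x n)) \<bullet> e)"
      using prkcd_stage_eigenvector[of A e "c e" \<omega>\<^sub>0 g h \<omega>\<^sub>1 "x n" s] sym c[OF e] ce T_pos iter
      by (simp add: prkcd_step_def p_def z_def)
  next
    show "0 < \<alpha> * (1 + \<gamma>)" using \<alpha> gamma by simp
  qed (use E sym g beta \<alpha> gamma h\<beta> xstar f in \<open>auto simp: algebra_simps\<close>)
  then show "f (x (Suc n)) - f xstar \<le> (1 + \<gamma>)\<^sup>2 * \<alpha>\<^sup>2 * (f (x n) - f xstar)"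
    by (simp add: power_mult_distrib mult.commute)
qed

end
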